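(* Let $\phi\in\mathbb{R}$ with $\sin(2\phi)\neq0$, let $\chi_1,\dots,\chi_4\in\mathbb{C}$, $\lambda\in\mathbb{C}$, and let $$z_1=e^{i\phi},\quad z_2=-e^{-i\phi},\quad z_3=-e^{i\phi},\quad z_4=e^{-i\phi},$$ $P(z)=\prod_{j=1}^4(z-z_j)=z^4-2\cos(2\phi)z^2+1$, and $q_j=\frac1{16}\left(\sin(2\chi_j)\right)^2\prod_{k\neq j}(z_j-z_k)$ for $j=1,\dots,4$. Consider the Taylor series solutions $\mathcal{F}(z)=\sum_{n=0}^\infty f_nz^n$ about $z=0$ of the symmetric general Heun equation $$\mathcal{F}''+\frac12\left(\sum_{j=1}^4\frac1{z-z_j}\right)\mathcal{F}'+\frac1{P(z)}\left(\lambda+\sum_{j=1}^4\frac{q_j}{z-z_j}\right)\mathcal{F}=0,$$ where $f_0,f_1\in\mathbb{C}$ are arbitrary and the coefficients $f_n$, $n\ge2$, are given by the nine-term recurrence $f_n+\sum_{k=1}^8r_{n-k}f_{n-k}=0$ (with $f_m=0$ for $m<0$), in which $$\begin{aligned} r_{n-1}&=0,\\ r_{n-2}&=\tfrac1{n(n-1)}\left(\lambda-\tfrac i4\sin(2\phi)\rho_2\right)-4\left(1-\tfrac5n+\tfrac32\tfrac1{n-1}\right)\cos(2\phi),\\ r_{n-3}&=-\tfrac1{n(n-1)}\tfrac i4\sin(2\phi)\rho_3,\\ r_{n-4}&=\tfrac1{n(n-1)}\left(-2\lambda\cos(2\phi)+\tfrac i4\sin(2\phi)\rho_4\right)+2\left(1-\tfrac{16}n+\tfrac9{n-1}\right)\left(2(\cos(2\phi))^2+1\right),\\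 r_{n-5}&=\tfrac1{n(n-1)}\tfrac i4\sin(2\phi)\rho_5,\\ r_{n-6}&=\tfrac\lambda{n(n-1)}-4\left(1-\tfrac{33}n+\tfrac{45}2\tfrac1{n-1}\right)\cos(2\phi),\\ r_{n-7}&=0,\\ r_{n-8}&=1-\tfrac{56}n+\tfrac{42}{n-1}. \end{aligned}$$ Then the series $\sum_{n=0}^\infty f_nz^n$ is absolutely convergent inside the unit circle, i.e. for every $z\in\mathbb{C}$ with $|z|<1$.
   Context: With $S_j=(\sin(2\chi_j))^2$, the quantities $\rho_2,\dots,\rho_5$ are $$\begin{aligned} \rho_2&=(S_1+S_3)-(S_2+S_4),\\ \rho_3&=e^{-i\phi}(S_1-S_3)+e^{i\phi}(S_2-S_4),\\ \rho_4&=e^{2i\phi}(S_1+S_3)-e^{-2i\phi}(S_2+S_4),\\ \rho_5&=e^{i\phi}(S_1-S_3)+e^{-i\phi}(S_2-S_4). \end{aligned}$$ The coefficients $r_{n-k}$ depend on $n$ as well as on $k$ (i.e. $r_{n-k}$ is the coefficient of $f_{n-k}$ in the $n$-th recurrence relation). The situation $\phi\in\mathbb{R}$, in which the four singular points lie on the unit circle, is called the circular case. The condition $\sin(2\phi)\neq0$ says that $z_1,\dots,z_4$ are distinct. *)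

theory Defs
  imports "HOL-Analysis.Analysis"
begin

definition heun_pt :: "real \<Rightarrow> nat \<Rightarrow> complex" where
  "heun_pt \<phi> j =
     (if j = 1 then exp (\<i> * of_real \<phi>)
      else if j = 2 then - exp (- \<i> * of_real \<phi>)
      else if j = 3 then - exp (\<i> * of_real \<phi>)
      else exp (- \<i> * of_real \<phi>))"

definition heun_P :: "real \<Rightarrow> complex \<Rightarrow> complex" where
  "heun_P \<phi> z = (\<Prod>j=1..4. z - heun_pt \<phi> j)"

lemma heun_P_eq: "heun_P \<phi> z = z ^ 4 - 2 * of_real (cos (2 * \<phi>)) * z ^ 2 + 1"
proof -
  define a where "a = exp (\<i> * of_real \<phi>)"
  define b where "b = exp (- (\<i> * of_real \<phi>))"
  have ab: "a * b = 1"
    by (simp add: a_def b_def flip: exp_add)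
  have sq: "a ^ 2 = exp (\<i> * of_real (2 * \<phi>))" "b ^ 2 = exp (- (\<i> * of_real (2 * \<phi>)))"
    by (simp_all add: a_def b_def power2_eq_square algebra_simps flip: exp_add)
  have c: "2 * of_real (cos (2 * \<phi>)) = a ^ 2 + b ^ 2"
    unfolding sq cos_of_real [symmetric] by (simp add: cos_exp_eq)
  have "{1..4::nat} = {1, 2, 3, 4}"
    by auto
  then have "heun_P \<phi> z = (z - a) * (z + b) * (z + a) * (z - b)"
    by (simp add: heun_P_def heun_pt_def a_def b_def)
  also have "\<dots> = z ^ 4 - (a ^ 2 + b ^ 2) * z ^ 2 + (a * b) ^ 2"
    by algebra
  finally show ?thesis
    by (simp add: ab c)
qed

definition heun_S :: "(nat \<Rightarrow> complex) \<Rightarrow> nat \<Rightarrow> complex" where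
  "heun_S chi j = (sin (2 * chi j)) ^ 2"

definition heun_q :: "real \<Rightarrow> (nat \<Rightarrow> complex) \<Rightarrow> nat \<Rightarrow> complex" where
  "heun_q \<phi> chi j =
     1 / 16 * (sin (2 * chi j)) ^ 2 * (\<Prod>k\<in>{1..4} - {j}. heun_pt \<phi> j - heun_pt \<phi> k)"

definition heun_solution_on ::
  "complex set \<Rightarrow> real \<Rightarrow> (nat \<Rightarrow> complex) \<Rightarrow> complex \<Rightarrow> (complex \<Rightarrow> complex) \<Rightarrow> bool" where
  "heun_solution_on A \<phi> chi l F \<longleftrightarrow> F holomorphic_on A \<and>
     (\<forall>z\<in>A. deriv (deriv F) z
        + 1 / 2 * (\<Sum>j=1..4. 1 / (z - heun_pt \<phi> j)) * deriv F z
        + 1 / heun_P \<phi> z * (l + (\<Sum>j=1..4. heun_q \<phi> chi j / (z - heun_pt \<phi> j))) * F z = 0)"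

definition heun_rho2 :: "(nat \<Rightarrow> complex) \<Rightarrow> complex" where
  "heun_rho2 chi = (heun_S chi 1 + heun_S chi 3) - (heun_S chi 2 + heun_S chi 4)"

definition heun_rho3 :: "real \<Rightarrow> (nat \<Rightarrow> complex) \<Rightarrow> complex" where
  "heun_rho3 \<phi> chi = exp (- \<i> * of_real \<phi>) * (heun_S chi 1 - heun_S chi 3)
     + exp (\<i> * of_real \<phi>) * (heun_S chi 2 - heun_S chi 4)"

definition heun_rho4 :: "real \<Rightarrow> (nat \<Rightarrow> complex) \<Rightarrow> complex" where
  "heun_rho4 \<phi> chi = exp (2 * \<i> * of_real \<phi>) * (heun_S chi 1 + heun_S chi 3)
     - exp (- 2 * \<i> * of_real \<phi>) * (heun_S chi 2 + heun_S chi 4)"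

definition heun_rho5 :: "real \<Rightarrow> (nat \<Rightarrow> complex) \<Rightarrow> complex" where
  "heun_rho5 \<phi> chi = exp (\<i> * of_real \<phi>) * (heun_S chi 1 - heun_S chi 3)
     + exp (- \<i> * of_real \<phi>) * (heun_S chi 2 - heun_S chi 4)"

(* heun_r \<phi> chi l n k is the coefficient written r_(n-k): the factor of f_(n-k) in the n-th relation.
   It is only meant for n \<ge> 2 and 1 \<le> k \<le> 8. *)
definition heun_r :: "real \<Rightarrow> (nat \<Rightarrow> complex) \<Rightarrow> complex \<Rightarrow> nat \<Rightarrow> nat \<Rightarrow> complex" where
  "heun_r \<phi> chi l n k =
     (let N = of_nat n; c = of_real (cos (2 * \<phi>)); s = of_real (sin (2 * \<phi>)) in
      if k = 2 then 1 / (N * (N - 1)) * (l - \<i> / 4 * s * heun_rho2 chi)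
        - 4 * (1 - 5 / N + 3 / 2 * (1 / (N - 1))) * c
      else if k = 3 then - (1 / (N * (N - 1)) * (\<i> / 4) * s * heun_rho3 \<phi> chi)
      else if k = 4 then 1 / (N * (N - 1)) * (- 2 * l * c + \<i> / 4 * s * heun_rho4 \<phi> chi)
        + 2 * (1 - 16 / N + 9 / (N - 1)) * (2 * c ^ 2 + 1)
      else if k = 5 then 1 / (N * (N - 1)) * (\<i> / 4) * s * heun_rho5 \<phi> chi
      else if k = 6 then l / (N * (N - 1)) - 4 * (1 - 33 / N + 45 / 2 * (1 / (N - 1))) * c
      else if k = 8 then 1 - 56 / N + 42 / (N - 1)
      else 0)"

end

theory Submission
  imports Defs "HOL-Complex_Analysis.Cauchy_Integral_Formula"
begin

text \<open>As \<open>n\<close> grows, the recurrence tends to the one with constant coefficients \<open>P\<^sup>2\<close>, whose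
  zeros all lie on the unit circle; so \<open>1 / P\<^sup>2\<close> has radius of convergence at least 1, and a
  perturbation argument carries this over to the series itself. The differential equation
  multiplied by \<open>P\<^sup>2\<close> has polynomial coefficients, and comparing coefficients in it gives exactly
  the recurrence.\<close>

section \<open>Weighted partial sums of power series, and perturbed recurrences\<close>

text \<open>Partial sums are finite before any convergence is known, so an inequality between them
  can be rearranged freely.\<close>

definition fps_weight :: "real \<Rightarrow> nat \<Rightarrow> complex fps \<Rightarrow> real" where
  "fps_weight r N F = (\<Sum>n\<le>N. norm (fps_nth F n) * r ^ n)"

lemma fps_weight_nonneg: "0 \<le> r \<Longrightarrow> 0 \<le> fps_weight r N F"
  by (simp add: fps_weight_def sum_nonneg)

text \<open>The terms of the truncated Cauchy product fill the triangle i + j <= N, which lies in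
  the square summed on the right.\<close>

lemma fps_weight_mult:
  assumes "0 \<le> r"
  shows "fps_weight r N (F * G) \<le> fps_weight r N F * fps_weight r N G"
proof -
  define g where "g i j = norm (fps_nth F i) * r ^ i * (norm (fps_nth G j) * r ^ j)" for i j
  have "norm (fps_nth (F * G) n) * r ^ n \<le> (\<Sum>i\<le>n. g i (n - i))" for n
  proof -
    have "norm (fps_nth (F * G) n) \<le> (\<Sum>i\<le>n. norm (fps_nth F i * fps_nth G (n - i)))"
      unfolding fps_mult_nth atLeast0AtMost by (rule norm_sum)
    then have "norm (fps_nth (F * G) n) * r ^ n
        \<le> (\<Sum>i\<le>n. norm (fps_nth F i * fps_nth G (n - i))) * r ^ n"
      using assms by (intro mult_right_mono) auto
    also have "\<dots> = (\<Sum>i\<le>n. g i (n - i))"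
      unfolding sum_distrib_right
    proof (rule sum.cong)
      fix i assume "i \<in> {..n}"
      then have "r ^ n = r ^ i * r ^ (n - i)"
        by (simp flip: power_add)
      then show "norm (fps_nth F i * fps_nth G (n - i)) * r ^ n = g i (n - i)"
        by (simp add: g_def norm_mult)
    qed simp
    finally show ?thesis .
  qed
  then have "fps_weight r N (F * G) \<le> (\<Sum>n\<le>N. \<Sum>i\<le>n. g i (n - i))"
    unfolding fps_weight_def by (intro sum_mono)
  also have "\<dots> = (\<Sum>(i, j)\<in>{(i, j). i + j \<le> N}. g i j)"
    by (rule sum.triangle_reindex_eq [symmetric])
  also have "\<dots> \<le> (\<Sum>(i, j)\<in>{..N} \<times> {..N}. g i j)"
    using assms by (intro sum_mono2) (auto simp: g_def)
  also have "\<dots> = fps_weight r N F * fps_weight r N G"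
    by (simp add: fps_weight_def g_def sum_product sum.cartesian_product)
  finally show ?thesis .
qed

text \<open>Submultiplicativity applies, since \<open>fps_X ^ k\<close> alone has weight r ^ k or 0,
  at most 1 for r in the unit interval.\<close>

lemma fps_weight_X_power_mult:
  assumes "0 \<le> r" "r \<le> 1"
  shows "fps_weight r N (fps_X ^ k * F) \<le> fps_weight r N F"
proof -
  have "fps_weight r N (fps_X ^ k) = (\<Sum>n\<le>N. if n = k then r ^ n else 0)"
    unfolding fps_weight_def by (intro sum.cong) auto
  also have "\<dots> \<le> 1"
    using assms by (simp add: power_le_one)
  finally have "fps_weight r N (fps_X ^ k) * fps_weight r N F \<le> 1 * fps_weight r N F"
    using assms by (intro mult_right_mono fps_weight_nonneg)
  with fps_weight_mult [OF assms(1), of N "fps_X ^ k" F] show ?thesis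
    by simp
qed

lemma fps_weight_le_suminf:
  assumes "0 \<le> r" "ereal r < fps_conv_radius F"
  shows "fps_weight r N F \<le> (\<Sum>n. norm (fps_nth F n) * r ^ n)"
proof -
  have "summable (\<lambda>n. norm (fps_nth F n * of_real r ^ n))"
    using assms by (intro norm_summable_fps) simp
  then have "summable (\<lambda>n. norm (fps_nth F n) * r ^ n)"
    using assms by (simp add: norm_mult norm_power)
  then show ?thesis
    unfolding fps_weight_def using assms by (intro sum_le_suminf) auto
qed

lemma fps_conv_radius_geI_weight:
  assumes "\<And>r. 0 < r \<Longrightarrow> ereal r < R \<Longrightarrow> \<exists>B. \<forall>N. fps_weight r N F \<le> B"
  shows "R \<le> fps_conv_radius F"
  unfolding fps_conv_radius_def
proof (rule conv_radius_geI_ex')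
  fix r :: real assume r: "0 < r" "ereal r < R"
  from assms [OF this] obtain B where B: "\<And>N. fps_weight r N F \<le> B"
    by blast
  have "summable (\<lambda>n. norm (fps_nth F n * of_real r ^ n))"
    using B r by (intro bounded_imp_summable [where B = B])
      (auto simp: fps_weight_def norm_mult norm_power)
  then show "summable (\<lambda>n. fps_nth F n * of_real r ^ n)"
    by (rule summable_norm_cancel)
qed

text \<open>A one-sided Poincare--Perron theorem. Writing \<open>F = inverse Q * (Q * F)\<close>, the weighted
  partial sums of \<open>F\<close> are at most a constant times those of \<open>Q * F\<close>, which by the recurrence are
  at most a constant plus an arbitrarily small multiple of those of \<open>F\<close> itself.\<close>

lemma fps_conv_radius_perturbed_recurrence:
  fixes F Q :: "complex fps" and e :: "nat \<Rightarrow> nat \<Rightarrow> complex"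
  assumes Q0: "fps_nth Q 0 \<noteq> 0" and Q: "1 \<le> fps_conv_radius (inverse Q)"
    and rec: "\<And>n. n \<ge> n0 \<Longrightarrow>
      fps_nth (Q * F) n = (\<Sum>k\<le>d. e n k * fps_nth (fps_X ^ k * F) n)"
    and lim: "\<And>k. k \<le> d \<Longrightarrow> (\<lambda>n. e n k) \<longlonglongrightarrow> 0"
  shows "1 \<le> fps_conv_radius F"
proof (rule fps_conv_radius_geI_weight)
  fix r :: real assume r: "0 < r" "ereal r < 1"
  then have r1: "0 \<le> r" "r \<le> 1"
    by auto
  define H where "H = (\<Sum>n. norm (fps_nth (inverse Q) n) * r ^ n)"
  have H: "fps_weight r N (inverse Q) \<le> H" for N
    unfolding H_def using r1 less_le_trans [OF r(2) Q] by (intro fps_weight_le_suminf)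
  have H0: "0 \<le> H"
    using fps_weight_nonneg [OF r1(1)] H order_trans by blast
  \<comment> \<open>This choice makes H times the total error of the d + 1 terms at most 1/2; H + 1
    keeps the denominator positive even if H = 0.\<close>
  define \<delta> where "\<delta> = 1 / (2 * (H + 1)) / (real d + 1)"
  have \<delta>: "0 < \<delta>" "H * (\<delta> * (real d + 1)) \<le> 1 / 2"
  proof -
    show "0 < \<delta>"
      using H0 by (simp add: \<delta>_def)
    have "real d + 1 \<noteq> 0"
      by linarith
    then have "\<delta> * (real d + 1) = 1 / (2 * (H + 1))"
      unfolding \<delta>_def by (rule nonzero_eq_divide_eq [THEN iffD1]) simp
    then have "H * (\<delta> * (real d + 1)) = H / (2 * (H + 1))"
      by simp
    also have "\<dots> \<le> 1 / 2"
      using H0 by (simp add: divide_simps)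
    finally show "H * (\<delta> * (real d + 1)) \<le> 1 / 2" .
  qed
  have "eventually (\<lambda>n. norm (e n k) < \<delta>) sequentially" if "k \<le> d" for k
    using tendstoD [OF lim [OF that] \<delta>(1)] by simp
  then have "eventually (\<lambda>n. \<forall>k\<in>{..d}. norm (e n k) < \<delta>) sequentially"
    by (intro eventually_ball_finite) auto
  then have "eventually (\<lambda>n. n0 \<le> n \<and> (\<forall>k\<in>{..d}. norm (e n k) < \<delta>)) sequentially"
    using eventually_ge_at_top [of n0] by eventually_elim auto
  then obtain n1 where n1: "\<And>n. n \<ge> n1 \<Longrightarrow> n0 \<le> n \<and> (\<forall>k\<in>{..d}. norm (e n k) < \<delta>)"
    by (auto simp: eventually_sequentially)
  \<comment> \<open>Collects the finitely many indices at which the errors need not be small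
    yet.\<close>
  define K where "K = (\<Sum>n<n1. norm (fps_nth (Q * F) n) * r ^ n)"
  have K0: "0 \<le> K"
    using r1 by (simp add: K_def sum_nonneg)
  have QF: "fps_weight r N (Q * F) \<le> K + \<delta> * (real d + 1) * fps_weight r N F" for N
  proof -
    have "norm (fps_nth (Q * F) n) * r ^ n
        \<le> (if n < n1 then norm (fps_nth (Q * F) n) * r ^ n else 0)
           + \<delta> * (\<Sum>k\<le>d. norm (fps_nth (fps_X ^ k * F) n) * r ^ n)" for n
    proof (cases "n < n1")
      case True
      then show ?thesis
        using r1 \<delta> by (simp add: sum_nonneg)
    next
      case False
      then have n: "n0 \<le> n" "\<And>k. k \<le> d \<Longrightarrow> norm (e n k) \<le> \<delta>"
        using n1 [of n] by (auto intro: less_imp_le)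
      have "norm (fps_nth (Q * F) n) \<le> (\<Sum>k\<le>d. norm (e n k * fps_nth (fps_X ^ k * F) n))"
        unfolding rec [OF n(1)] by (rule norm_sum)
      also have "\<dots> \<le> (\<Sum>k\<le>d. \<delta> * norm (fps_nth (fps_X ^ k * F) n))"
        unfolding norm_mult using n by (intro sum_mono mult_right_mono) auto
      finally have "norm (fps_nth (Q * F) n) * r ^ n
          \<le> (\<Sum>k\<le>d. \<delta> * norm (fps_nth (fps_X ^ k * F) n)) * r ^ n"
        using r1 by (intro mult_right_mono) auto
      then show ?thesis
        using False by (simp add: sum_distrib_left sum_distrib_right mult.assoc)
    qed
    then have "fps_weight r N (Q * F)
        \<le> (\<Sum>n\<le>N. (if n < n1 then norm (fps_nth (Q * F) n) * r ^ n else 0)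
           + \<delta> * (\<Sum>k\<le>d. norm (fps_nth (fps_X ^ k * F) n) * r ^ n))"
      unfolding fps_weight_def by (intro sum_mono)
    also have "\<dots> = (\<Sum>n\<le>N. if n < n1 then norm (fps_nth (Q * F) n) * r ^ n else 0)
           + \<delta> * (\<Sum>k\<le>d. fps_weight r N (fps_X ^ k * F))"
      unfolding fps_weight_def sum.distrib sum_distrib_left [symmetric]
      by (subst sum.swap) simp
    also have "(\<Sum>n\<le>N. if n < n1 then norm (fps_nth (Q * F) n) * r ^ n else 0)
        = (\<Sum>n\<in>{n. n \<le> N \<and> n < n1}. norm (fps_nth (Q * F) n) * r ^ n)"
      by (subst sum.inter_filter [symmetric]) (auto simp: atMost_def)
    also have "\<dots> \<le> K"
      unfolding K_def using r1 by (intro sum_mono2) auto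
    also have "(\<Sum>k\<le>d. fps_weight r N (fps_X ^ k * F)) \<le> (\<Sum>k\<le>d. fps_weight r N F)"
      using r1 by (intro sum_mono fps_weight_X_power_mult)
    finally show ?thesis
      using \<delta>(1) by (simp add: algebra_simps)
  qed
  have "fps_weight r N F \<le> 2 * H * K" for N
  proof -
    have eq: "inverse Q * (Q * F) = F"
      using Q0 by (simp add: inverse_mult_eq_1 flip: mult.assoc)
    have "fps_weight r N F \<le> fps_weight r N (inverse Q) * fps_weight r N (Q * F)"
      using fps_weight_mult [OF r1(1), of N "inverse Q" "Q * F"] by (simp only: eq)
    also have "\<dots> \<le> H * (K + \<delta> * (real d + 1) * fps_weight r N F)"
      using H QF H0 r1 by (intro mult_mono fps_weight_nonneg)
    also have "\<dots> = H * K + H * (\<delta> * (real d + 1)) * fps_weight r N F"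
      by (simp add: algebra_simps)
    \<comment> \<open>The last term is half of the left-hand side and is absorbed there, leaving a
      bound independent of N.\<close>
    also have "\<dots> \<le> H * K + 1 / 2 * fps_weight r N F"
      using \<delta>(2) fps_weight_nonneg [OF r1(1)] by (intro add_left_mono mult_right_mono)
    finally show ?thesis
      by simp
  qed
  then show "\<exists>B. \<forall>N. fps_weight r N F \<le> B"
    by blast
qed

text \<open>Writing the shifted coefficient through \<open>fps_X ^ k * F\<close> makes it 0 for k >
  n, so the summation range need not depend on n.\<close>

lemma fps_nth_of_poly_mult:
  fixes F :: "complex fps"
  assumes "degree p \<le> d"
  shows "fps_nth (fps_of_poly p * F) n = (\<Sum>k\<le>d. coeff p k * fps_nth (fps_X ^ k * F) n)"
proof -
  have "p = (\<Sum>k\<le>d. monom (coeff p k) k)"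
    using poly_as_sum_of_monoms' [OF assms] by simp
  then have "fps_of_poly p = (\<Sum>k\<le>d. fps_const (coeff p k) * fps_X ^ k)"
    by (metis (no_types, lifting) fps_of_poly_monom fps_of_poly_sum sum.cong)
  then show ?thesis
    by (simp add: sum_distrib_right fps_sum_nth mult.assoc)
qed

section \<open>The Heun equation with denominators cleared\<close>

definition heun_p :: "real \<Rightarrow> complex poly" where
  "heun_p \<phi> = [:1, 0, - 2 * of_real (cos (2 * \<phi>)), 0, 1:]"

text \<open>This is P times the factor l + sum of q_j / (z - z_j), as \<open>heun_sum_q\<close>
  shows. Its coefficients are the numerators over n (n - 1) in \<open>heun_r\<close> for k = 2, ...,
  6.\<close>

definition heun_t :: "real \<Rightarrow> (nat \<Rightarrow> complex) \<Rightarrow> complex \<Rightarrow> complex poly" where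
  "heun_t \<phi> chi l = (let c = of_real (cos (2 * \<phi>)); s = of_real (sin (2 * \<phi>)) in
     [:l - \<i> / 4 * s * heun_rho2 chi, - (\<i> / 4 * s * heun_rho3 \<phi> chi),
       - 2 * l * c + \<i> / 4 * s * heun_rho4 \<phi> chi, \<i> / 4 * s * heun_rho5 \<phi> chi, l:])"

lemma poly_heun_p: "poly (heun_p \<phi>) z = heun_P \<phi> z"
  by (simp add: heun_P_eq heun_p_def algebra_simps power2_eq_square power4_eq_xxxx)

lemma norm_heun_pt [simp]: "norm (heun_pt \<phi> j) = 1"
  by (simp add: heun_pt_def)

lemma heun_P_nonzero: "norm z < 1 \<Longrightarrow> heun_P \<phi> z \<noteq> 0"
  by (auto simp: heun_P_def)

lemma atLeastAtMost_1_4: "{1..4::nat} = {1, 2, 3, 4}"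
  by auto

lemma partial_fractions_4:
  fixes x y u v :: "'a::field"
  assumes "x \<noteq> 0" "y \<noteq> 0" "u \<noteq> 0" "v \<noteq> 0"
  shows "x * y * u * v * (l + A / x + B / y + C / u + D / v)
    = l * (x * y * u * v) + A * (y * u * v) + B * (x * u * v) + C * (x * y * v) + D * (x * y * u)"
  using assms by (simp add: field_simps)

text \<open>The logarithmic derivative of P. With the four points written a, -b, -a, b, it becomes a
  polynomial identity.\<close>

lemma heun_sum_inverse:
  assumes "heun_P \<phi> z \<noteq> 0"
  shows "heun_P \<phi> z * (\<Sum>j=1..4. 1 / (z - heun_pt \<phi> j)) = poly (pderiv (heun_p \<phi>)) z"
proof -
  define a where "a = exp (\<i> * of_real \<phi>)"
  define b where "b = exp (- (\<i> * of_real \<phi>))"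
  have sq: "a ^ 2 = exp (\<i> * of_real (2 * \<phi>))" "b ^ 2 = exp (- (\<i> * of_real (2 * \<phi>)))"
    by (simp_all add: a_def b_def power2_eq_square algebra_simps flip: exp_add)
  have c: "2 * of_real (cos (2 * \<phi>)) = a ^ 2 + b ^ 2"
    unfolding sq cos_of_real [symmetric] by (simp add: cos_exp_eq)
  have pt: "heun_pt \<phi> 1 = a" "heun_pt \<phi> 2 = - b" "heun_pt \<phi> 3 = - a" "heun_pt \<phi> 4 = b"
    by (simp_all add: heun_pt_def a_def b_def)
  have P: "heun_P \<phi> z = (z - a) * (z + b) * (z + a) * (z - b)"
    by (simp add: heun_P_def atLeastAtMost_1_4 pt flip: One_nat_def)
  have nz: "z - a \<noteq> 0" "z + b \<noteq> 0" "z + a \<noteq> 0" "z - b \<noteq> 0"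
    using assms by (auto simp: P)
  have "heun_P \<phi> z * (\<Sum>j=1..4. 1 / (z - heun_pt \<phi> j))
      = heun_P \<phi> z * (1 / (z - a) + 1 / (z + b) + 1 / (z + a) + 1 / (z - b))"
    by (simp add: atLeastAtMost_1_4 pt flip: One_nat_def)
  also have "\<dots> = (z + b) * (z + a) * (z - b) + (z - a) * (z + a) * (z - b)
       + (z - a) * (z + b) * (z - b) + (z - a) * (z + b) * (z + a)"
    unfolding P using partial_fractions_4 [OF nz, of 0 1 1 1 1] by simp
  also have "\<dots> = 4 * z ^ 3 - 2 * (a ^ 2 + b ^ 2) * z"
    by algebra
  also have "\<dots> = poly (pderiv (heun_p \<phi>)) z"
    by (simp add: heun_p_def pderiv_pCons c [symmetric] algebra_simps power3_eq_cube)
  finally show ?thesis .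
qed

text \<open>Each q_j is S_j * u times the point z_j, with sign + for odd j and - for even j, so
  collecting powers of z produces exactly the four rho combinations.\<close>

lemma heun_sum_q:
  assumes "heun_P \<phi> z \<noteq> 0"
  shows "heun_P \<phi> z * (l + (\<Sum>j=1..4. heun_q \<phi> chi j / (z - heun_pt \<phi> j)))
           = poly (heun_t \<phi> chi l) z"
proof -
  define a where "a = exp (\<i> * of_real \<phi>)"
  define b where "b = exp (- (\<i> * of_real \<phi>))"
  define c :: complex where "c = of_real (cos (2 * \<phi>))"
  define u :: complex where "u = \<i> / 4 * of_real (sin (2 * \<phi>))"
  define S where "S j = heun_S chi j" for j
  have ab: "a * b = 1"
    by (simp add: a_def b_def flip: exp_add)
  have sq: "a ^ 2 = exp (\<i> * of_real (2 * \<phi>))" "b ^ 2 = exp (- (\<i> * of_real (2 * \<phi>)))"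
    by (simp_all add: a_def b_def power2_eq_square algebra_simps flip: exp_add)
  have sq': "exp (2 * \<i> * of_real \<phi>) = a ^ 2" "exp (- 2 * \<i> * of_real \<phi>) = b ^ 2"
    unfolding sq by (simp_all add: mult.commute mult.left_commute)
  have c: "2 * c = a ^ 2 + b ^ 2"
    unfolding sq c_def cos_of_real [symmetric] by (simp add: cos_exp_eq)
  have u: "8 * u = a ^ 2 - b ^ 2"
    unfolding sq u_def sin_of_real [symmetric] by (simp add: sin_exp_eq field_simps)
  have pt: "heun_pt \<phi> 1 = a" "heun_pt \<phi> 2 = - b" "heun_pt \<phi> 3 = - a" "heun_pt \<phi> 4 = b"
    by (simp_all add: heun_pt_def a_def b_def)
  have P: "heun_P \<phi> z = (z - a) * (z + b) * (z + a) * (z - b)"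
    by (simp add: heun_P_def atLeastAtMost_1_4 pt flip: One_nat_def)
  have nz: "z - a \<noteq> 0" "z + b \<noteq> 0" "z + a \<noteq> 0" "z - b \<noteq> 0"
    using assms by (auto simp: P)
  have sets: "{1::nat, 2, 3, 4} - {1} = {2, 3, 4}" "{1::nat, 2, 3, 4} - {2} = {1, 3, 4}"
    "{1::nat, 2, 3, 4} - {3} = {1, 2, 4}" "{1::nat, 2, 3, 4} - {4} = {1, 2, 3}"
    by auto
  have "16 * heun_q \<phi> chi 1 = S 1 * ((a + b) * (a + a) * (a - b))"
    "16 * heun_q \<phi> chi 2 = S 2 * ((- b - a) * (- b + a) * (- b - b))"
    "16 * heun_q \<phi> chi 3 = S 3 * ((- a - a) * (- a + b) * (- a - b))"
    "16 * heun_q \<phi> chi 4 = S 4 * ((b - a) * (b + b) * (b + a))"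
    unfolding heun_q_def atLeastAtMost_1_4 sets S_def heun_S_def
    by (simp_all add: pt flip: One_nat_def)
  \<comment> \<open>For instance (a + b) * 2a * (a - b) = 2a * (a^2 - b^2) = 16 * u * a.\<close>
  then have q: "heun_q \<phi> chi 1 = S 1 * u * a" "heun_q \<phi> chi 2 = S 2 * u * b"
    "heun_q \<phi> chi 3 = - S 3 * u * a" "heun_q \<phi> chi 4 = - S 4 * u * b"
    using u by algebra+
  have rho: "heun_rho2 chi = (S 1 + S 3) - (S 2 + S 4)"
    "heun_rho3 \<phi> chi = b * (S 1 - S 3) + a * (S 2 - S 4)"
    "heun_rho4 \<phi> chi = a ^ 2 * (S 1 + S 3) - b ^ 2 * (S 2 + S 4)"
    "heun_rho5 \<phi> chi = a * (S 1 - S 3) + b * (S 2 - S 4)"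
    unfolding heun_rho2_def heun_rho3_def heun_rho4_def heun_rho5_def sq' S_def
    by (simp_all add: a_def b_def)
  have "heun_P \<phi> z * (l + (\<Sum>j=1..4. heun_q \<phi> chi j / (z - heun_pt \<phi> j)))
      = heun_P \<phi> z * (l + heun_q \<phi> chi 1 / (z - a) + heun_q \<phi> chi 2 / (z + b)
          + heun_q \<phi> chi 3 / (z + a) + heun_q \<phi> chi 4 / (z - b))"
    by (simp add: atLeastAtMost_1_4 pt add.assoc flip: One_nat_def)
  also have "\<dots> = l * ((z - a) * (z + b) * (z + a) * (z - b))
       + heun_q \<phi> chi 1 * ((z + b) * (z + a) * (z - b))
       + heun_q \<phi> chi 2 * ((z - a) * (z + a) * (z - b))
       + heun_q \<phi> chi 3 * ((z - a) * (z + b) * (z - b))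
       + heun_q \<phi> chi 4 * ((z - a) * (z + b) * (z + a))"
    unfolding P by (rule partial_fractions_4 [OF nz])
  also have "\<dots> = (l - u * heun_rho2 chi) + z * (- (u * heun_rho3 \<phi> chi)
       + z * (- 2 * l * c + u * heun_rho4 \<phi> chi + z * (u * heun_rho5 \<phi> chi + z * l)))"
    \<comment> \<open>The relation a * b = 1 reduces the mixed products, such as a * b^2 to b and
      a^2 * b^2 to 1.\<close>
    unfolding q rho using ab c by algebra
  also have "\<dots> = poly (heun_t \<phi> chi l) z"
    by (simp add: heun_t_def u_def c_def Let_def)
  finally show ?thesis .
qed

section \<open>The recurrence as the coefficient form of the equation\<close>

text \<open>The factor of F'' after multiplication by P^2; its coefficients are also the limits of
  \<open>heun_r\<close> as n grows.\<close>

definition heun_A :: "real \<Rightarrow> complex poly" where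
  "heun_A \<phi> = heun_p \<phi> * heun_p \<phi>"

text \<open>The factor of F' after multiplication by P^2, since the sum of the 1 / (z - z_j) is P' /
  P.\<close>

definition heun_B :: "real \<Rightarrow> complex poly" where
  "heun_B \<phi> = smult (1 / 2) (heun_p \<phi> * pderiv (heun_p \<phi>))"

lemma heun_A_eq:
  "heun_A \<phi> = (let c = of_real (cos (2 * \<phi>)) in
     [:1, 0, - 4 * c, 0, 2 * (2 * c ^ 2 + 1), 0, - 4 * c, 0, 1:])"
  by (simp add: heun_A_def heun_p_def Let_def algebra_simps power2_eq_square)

lemma heun_B_eq:
  "heun_B \<phi> = (let c = of_real (cos (2 * \<phi>)) in
     [:0, - 2 * c, 0, 2 * (2 * c ^ 2 + 1), 0, - 6 * c, 0, 2:])"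
  by (simp add: heun_B_def heun_p_def Let_def pderiv_pCons algebra_simps power2_eq_square)

text \<open>One shape serves two purposes: the first conjunct exhibits the limit of the
  coefficients, the second identifies them, times n (n - 1), with those of the differential
  equation. The first holds even for n = 0 and n = 1, because 1 / 0 = 0 on both sides.\<close>

lemma heun_r_form:
  assumes "k \<in> {1..8}"
  shows "\<exists>\<alpha> \<beta>. (\<forall>n. heun_r \<phi> chi l n k
        = coeff (pCons 0 (pCons 0 (heun_t \<phi> chi l))) k * (1 / of_nat n * (1 / (of_nat n - 1)))
          + coeff (heun_A \<phi>) k * (1 + \<alpha> * (1 / of_nat n) + \<beta> * (1 / (of_nat n - 1)))) \<and>
      (\<forall>N. coeff (heun_A \<phi>) k * ((N - of_nat k) * (N - of_nat k - 1))
          + coeff (pCons 0 (heun_B \<phi>)) k * (N - of_nat k)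
        = coeff (heun_A \<phi>) k * (N * (N - 1) + \<alpha> * (N - 1) + \<beta> * N))"
    (is "\<exists>\<alpha> \<beta>. ?P k \<alpha> \<beta>")
proof -
  define c s :: complex where "c = of_real (cos (2 * \<phi>))" and "s = of_real (sin (2 * \<phi>))"
  have A: "coeff (heun_A \<phi>) 1 = 0" "coeff (heun_A \<phi>) 2 = - 4 * c" "coeff (heun_A \<phi>) 3 = 0"
    "coeff (heun_A \<phi>) 4 = 2 * (2 * c ^ 2 + 1)" "coeff (heun_A \<phi>) 5 = 0"
    "coeff (heun_A \<phi>) 6 = - 4 * c" "coeff (heun_A \<phi>) 7 = 0" "coeff (heun_A \<phi>) 8 = 1"
    by (simp_all add: heun_A_eq c_def Let_def eval_nat_numeral)
  let ?B = "pCons 0 (heun_B \<phi>)"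
  have B: "coeff ?B 1 = 0" "coeff ?B 2 = - 2 * c" "coeff ?B 3 = 0"
    "coeff ?B 4 = 2 * (2 * c ^ 2 + 1)" "coeff ?B 5 = 0" "coeff ?B 6 = - 6 * c"
    "coeff ?B 7 = 0" "coeff ?B 8 = 2"
    by (simp_all add: heun_B_eq c_def Let_def eval_nat_numeral)
  let ?T = "pCons 0 (pCons 0 (heun_t \<phi> chi l))"
  have T: "coeff ?T 1 = 0" "coeff ?T 2 = l - \<i> / 4 * s * heun_rho2 chi"
    "coeff ?T 3 = - (\<i> / 4 * s * heun_rho3 \<phi> chi)"
    "coeff ?T 4 = - 2 * l * c + \<i> / 4 * s * heun_rho4 \<phi> chi"
    "coeff ?T 5 = \<i> / 4 * s * heun_rho5 \<phi> chi" "coeff ?T 6 = l"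
    "coeff ?T 7 = 0" "coeff ?T 8 = 0"
    by (simp_all add: heun_t_def c_def s_def Let_def eval_nat_numeral)
  note coeffs = A B T
  \<comment> \<open>For odd k the coefficients of \<open>heun_A\<close> and of the shifted
    \<open>heun_B\<close> vanish, so zero witnesses suffice.\<close>
  have "?P 1 0 0" "?P 3 0 0" "?P 5 0 0" "?P 7 0 0"
    unfolding coeffs by (simp_all add: heun_r_def Let_def s_def)
  \<comment> \<open>For even k the witnesses are the numerators of 1 / n and 1 / (n - 1) in
    \<open>heun_r\<close>.\<close>
  moreover have "?P 2 (- 5) (3 / 2)"
    unfolding coeffs by (simp add: heun_r_def Let_def c_def s_def) (simp add: algebra_simps)
  moreover have "?P 4 (- 16) 9"
    unfolding coeffs by (simp add: heun_r_def Let_def c_def s_def) (simp add: algebra_simps)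
  moreover have "?P 6 (- 33) (45 / 2)"
    unfolding coeffs by (simp add: heun_r_def Let_def c_def s_def) (simp add: algebra_simps)
  moreover have "?P 8 (- 56) 42"
    unfolding coeffs by (simp add: heun_r_def Let_def) (simp add: algebra_simps)
  moreover have "k = 1 \<or> k = 2 \<or> k = 3 \<or> k = 4 \<or> k = 5 \<or> k = 6 \<or> k = 7 \<or> k = 8"
    using assms by auto
  ultimately show ?thesis
    by (elim disjE) (hypsubst, blast)+
qed

text \<open>The left-hand side of the equation times P^2, as a formal series, so that its vanishing
  can be proved independently of convergence.\<close>

definition heun_fps :: "real \<Rightarrow> (nat \<Rightarrow> complex) \<Rightarrow> complex \<Rightarrow> complex fps \<Rightarrow> complex fps" where
  "heun_fps \<phi> chi l F = fps_of_poly (heun_A \<phi>) * fps_deriv (fps_deriv F)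
     + fps_of_poly (heun_B \<phi>) * fps_deriv F + fps_of_poly (heun_t \<phi> chi l) * F"

text \<open>Multiplying by \<open>X\<^sup>2\<close> turns the derivatives into \<open>X F'\<close> and \<open>X\<^sup>2 F''\<close>, whose coefficients
  \<open>n f\<^sub>n\<close> and \<open>n (n - 1) f\<^sub>n\<close> need no index shift.\<close>

lemma heun_fps_eq_0:
  assumes rec: "\<And>n. n \<ge> 2 \<Longrightarrow>
    fps_nth F n + (\<Sum>k=1..8. heun_r \<phi> chi l n k * fps_nth (fps_X ^ k * F) n) = 0"
  shows "heun_fps \<phi> chi l F = 0"
proof -
  define D where "D = fps_X * fps_deriv F"
  define E where "E = fps_X ^ 2 * fps_deriv (fps_deriv F)"
  have D0: "fps_nth D m = of_nat m * fps_nth F m" for m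
    by (cases m) (auto simp: D_def)
  have E0: "fps_nth E m = of_nat m * (of_nat m - 1) * fps_nth F m" for m
  proof (cases "m < 2")
    case True
    then have "m = 0 \<or> m = 1"
      by auto
    then show ?thesis
      by (auto simp: E_def fps_X_power_mult_nth)
  next
    case False
    then obtain j where j: "m = j + 2"
      by (metis add.commute le_Suc_ex not_less)
    have "fps_nth E m = fps_nth (fps_deriv (fps_deriv F)) j"
      by (simp add: E_def j fps_X_power_mult_nth)
    then show ?thesis
      by (simp add: j algebra_simps)
  qed
  have D: "fps_nth (fps_X ^ k * D) n = (of_nat n - of_nat k) * fps_nth (fps_X ^ k * F) n" for k n
    by (simp add: D0 fps_X_power_mult_nth of_nat_diff)
  have E: "fps_nth (fps_X ^ k * E) n
      = (of_nat n - of_nat k) * (of_nat n - of_nat k - 1) * fps_nth (fps_X ^ k * F) n" for k n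
    by (simp add: E0 fps_X_power_mult_nth of_nat_diff)
  \<comment> \<open>Of the factor X^2, one X is absorbed by F' and the other by
    \<open>heun_B\<close>; \<open>heun_t\<close> absorbs both.\<close>
  define B where "B = pCons 0 (heun_B \<phi>)"
  define T where "T = pCons 0 (pCons 0 (heun_t \<phi> chi l))"
  have deg: "degree (heun_A \<phi>) \<le> 8" "degree B \<le> 8" "degree T \<le> 8"
    by (simp_all add: B_def T_def heun_A_eq heun_B_eq heun_t_def Let_def degree_pCons_eq_if)
  have shift: "fps_of_poly (pCons 0 p) = fps_X * fps_of_poly p" for p :: "complex poly"
    by (simp add: fps_of_poly_pCons mult.commute)
  have split: "fps_X ^ 2 * heun_fps \<phi> chi l F
      = fps_of_poly (heun_A \<phi>) * E + fps_of_poly B * D + fps_of_poly T * F"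
    unfolding heun_fps_def B_def T_def D_def E_def shift by algebra
  \<comment> \<open>The factor of f_(n-k) in the n-th coefficient of X^2 times the equation.\<close>
  define w where "w n k = coeff (heun_A \<phi>) k * ((of_nat n - of_nat k) * (of_nat n - of_nat k - 1))
      + coeff B k * (of_nat n - of_nat k) + coeff T k" for n k :: nat
  have nth: "fps_nth (fps_X ^ 2 * heun_fps \<phi> chi l F) n
      = (\<Sum>k\<le>8. w n k * fps_nth (fps_X ^ k * F) n)" for n
    unfolding split fps_add_nth deg [THEN fps_nth_of_poly_mult] D E w_def sum.distrib [symmetric]
    by (intro sum.cong refl) (simp only: distrib_right mult.assoc)
  have w0: "w n 0 = of_nat n * (of_nat n - 1)" and w1: "w n 1 = 0" for n
    by (simp_all add: w_def B_def T_def heun_A_eq heun_B_eq Let_def)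
  have wr: "w n k = of_nat n * (of_nat n - 1) * heun_r \<phi> chi l n k"
    if n: "n \<ge> 2" and k: "k \<in> {1..8}" for n k
  proof -
    have nz: "of_nat n \<noteq> (0 :: complex)" "of_nat n - 1 \<noteq> (0 :: complex)"
      using n of_nat_eq_iff [of n 1, where 'a = complex] by auto
    from heun_r_form [OF k, of \<phi> chi l] obtain \<alpha> \<beta> where
      r: "heun_r \<phi> chi l n k = coeff T k * (1 / of_nat n * (1 / (of_nat n - 1)))
          + coeff (heun_A \<phi>) k * (1 + \<alpha> * (1 / of_nat n) + \<beta> * (1 / (of_nat n - 1)))"
      and w: "w n k = coeff (heun_A \<phi>) k * (of_nat n * (of_nat n - 1)
          + \<alpha> * (of_nat n - 1) + \<beta> * of_nat n) + coeff T k"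
      unfolding w_def B_def T_def by metis
    have "N * M * (t * (1 / N * (1 / M)) + a * (1 + \<alpha> * (1 / N) + \<beta> * (1 / M)))
        = a * (N * M + \<alpha> * M + \<beta> * N) + t"
      if "N \<noteq> 0" "M \<noteq> 0" for N M t a :: complex
      using that by (simp add: field_simps)
    from this [OF nz] show ?thesis
      unfolding r w by simp
  qed
  have "fps_nth (fps_X ^ 2 * heun_fps \<phi> chi l F) n = 0" for n
  proof (cases "n \<ge> 2")
    case True
    have "{..8::nat} = insert 0 {1..8}"
      by auto
    then have "fps_nth (fps_X ^ 2 * heun_fps \<phi> chi l F) n
        = w n 0 * fps_nth F n + (\<Sum>k=1..8. w n k * fps_nth (fps_X ^ k * F) n)"
      unfolding nth by simp
    also have "(\<Sum>k=1..8. w n k * fps_nth (fps_X ^ k * F) n) = of_nat n * (of_nat n - 1)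
        * (\<Sum>k=1..8. heun_r \<phi> chi l n k * fps_nth (fps_X ^ k * F) n)"
      unfolding sum_distrib_left using True by (intro sum.cong) (auto simp: wr)
    finally show ?thesis
      by (simp only: w0 distrib_left [symmetric] rec [OF True] mult_zero_right)
  next
    case False
    have "w n k * fps_nth (fps_X ^ k * F) n = 0" for k
    proof -
      \<comment> \<open>For n < 2 every term vanishes: the shifted coefficient is 0 if k > n, n (n -
        1) is 0 if k = 0, and \<open>w n 1\<close> is 0. Hence f_0 and f_1 stay free.\<close>
      have "k > n \<or> n = 0 \<and> k = 0 \<or> n = 1 \<and> k = 0 \<or> k = 1"
        using False by auto
      then show ?thesis
        using w0 w1 by (auto simp: fps_X_power_mult_nth)
    qed
    then show ?thesis
      unfolding nth by (simp only: sum.neutral_const)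
  qed
  then have "fps_X ^ 2 * heun_fps \<phi> chi l F = 0"
    by (intro fps_ext) simp
  then show ?thesis
    by simp
qed

section \<open>Radius of convergence and the analytic solution\<close>

lemma heun_conv_radius:
  assumes rec: "\<And>n. n \<ge> 2 \<Longrightarrow>
    fps_nth F n + (\<Sum>k=1..8. heun_r \<phi> chi l n k * fps_nth (fps_X ^ k * F) n) = 0"
  shows "1 \<le> fps_conv_radius F"
proof (rule fps_conv_radius_perturbed_recurrence)
  define A where "A = heun_A \<phi>"
  define Q where "Q = fps_of_poly A"
  \<comment> \<open>The deviation from the constant-coefficient recurrence; it is 0 at k = 0, where
    both recurrences have leading coefficient 1.\<close>
  define e where "e n k = (if k = 0 then 0 else coeff A k - heun_r \<phi> chi l n k)" for n k
  have A0: "coeff A 0 = 1"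
    by (simp add: A_def heun_A_eq Let_def)
  show "fps_nth Q 0 \<noteq> 0"
    by (simp add: Q_def A0)
  \<comment> \<open>Q is P^2, which has no zero in the open unit disc.\<close>
  have "min 1 (fps_conv_radius Q) \<le> fps_conv_radius (inverse Q)"
    by (intro fps_conv_radius_inverse)
      (simp add: Q_def A_def heun_A_def poly_heun_p heun_P_nonzero one_ereal_def del: fps_of_poly_mult)
  then show "1 \<le> fps_conv_radius (inverse Q)"
    by (simp add: Q_def)
  have deg: "degree A \<le> 8"
    by (simp add: A_def heun_A_eq Let_def degree_pCons_eq_if)
  show "fps_nth (Q * F) n = (\<Sum>k\<le>8. e n k * fps_nth (fps_X ^ k * F) n)" if "n \<ge> 2" for n
  proof -
    have ins: "{..8::nat} = insert 0 {1..8}"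
      by auto
    have "fps_nth (Q * F) n = fps_nth F n + (\<Sum>k=1..8. coeff A k * fps_nth (fps_X ^ k * F) n)"
      unfolding Q_def fps_nth_of_poly_mult [OF deg] ins by (simp add: A0)
    also have "\<dots> = (\<Sum>k=1..8. coeff A k * fps_nth (fps_X ^ k * F) n)
        - (\<Sum>k=1..8. heun_r \<phi> chi l n k * fps_nth (fps_X ^ k * F) n)"
      using rec [OF that] by (simp add: algebra_simps add_eq_0_iff2)
    also have "\<dots> = (\<Sum>k=1..8. e n k * fps_nth (fps_X ^ k * F) n)"
      unfolding sum_subtractf [symmetric] by (intro sum.cong) (auto simp: e_def algebra_simps)
    finally show ?thesis
      unfolding ins by (simp add: e_def)
  qed
  show "(\<lambda>n. e n k) \<longlonglongrightarrow> 0" if "k \<le> 8" for k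
  proof (cases "k = 0")
    case False
    with that have k: "k \<in> {1..8}"
      by auto
    have x: "(\<lambda>n. 1 / of_nat n :: complex) \<longlonglongrightarrow> 0"
      by (rule lim_1_over_n)
    have "(\<lambda>n. 1 / (of_nat (Suc n) - 1) :: complex) \<longlonglongrightarrow> 0"
      using lim_1_over_n by simp
    then have y: "(\<lambda>n. 1 / (of_nat n - 1) :: complex) \<longlonglongrightarrow> 0"
      by (rule LIMSEQ_imp_Suc)
    from heun_r_form [OF k, of \<phi> chi l] obtain t \<alpha> \<beta> where
      "heun_r \<phi> chi l n k = t * (1 / of_nat n * (1 / (of_nat n - 1)))
        + coeff A k * (1 + \<alpha> * (1 / of_nat n) + \<beta> * (1 / (of_nat n - 1)))" for n
      unfolding A_def by blast
    then have r: "(\<lambda>n. heun_r \<phi> chi l n k) = (\<lambda>n. t * (1 / of_nat n * (1 / (of_nat n - 1)))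
        + coeff A k * (1 + \<alpha> * (1 / of_nat n) + \<beta> * (1 / (of_nat n - 1))))"
      by blast
    have "(\<lambda>n. heun_r \<phi> chi l n k) \<longlonglongrightarrow> t * (0 * 0) + coeff A k * (1 + \<alpha> * 0 + \<beta> * 0)"
      unfolding r by (intro tendsto_intros x y)
    then have "(\<lambda>n. coeff A k - heun_r \<phi> chi l n k) \<longlonglongrightarrow> coeff A k - coeff A k"
      by (intro tendsto_diff tendsto_const) simp
    with False show ?thesis
      by (simp add: e_def)
  qed (simp add: e_def)
qed

text \<open>Inside the disc the formal identity may be evaluated termwise; it then reads P^2 times
  the Heun equation, and P is nonzero there.\<close>

lemma heun_solution_eval_fps:
  assumes R: "1 \<le> fps_conv_radius F" and eq: "heun_fps \<phi> chi l F = 0"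
  shows "heun_solution_on (ball 0 1) \<phi> chi l (eval_fps F)"
  unfolding heun_solution_on_def
proof (intro conjI ballI)
  have "ball 0 1 \<subseteq> eball 0 (fps_conv_radius F)"
    using R by (intro ball_eball_mono) (simp add: one_ereal_def)
  then show "eval_fps F holomorphic_on ball 0 1"
    by (rule holomorphic_on_eval_fps)
  fix z :: complex assume "z \<in> ball 0 1"
  then have z1: "norm z < 1"
    by simp
  have R': "1 \<le> fps_conv_radius (fps_deriv F)"
    using R fps_conv_radius_deriv order_trans by blast
  then have R'': "1 \<le> fps_conv_radius (fps_deriv (fps_deriv F))"
    using fps_conv_radius_deriv order_trans by blast
  have rad: "ereal (norm w) < fps_conv_radius G" if "norm w < 1" "1 \<le> fps_conv_radius G"
    for w :: complex and G :: "complex fps"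
    using that(1) by (intro less_le_trans [OF _ that(2)]) (simp add: one_ereal_def)
  have d1: "deriv (eval_fps F) w = eval_fps (fps_deriv F) w" if "norm w < 1" for w
    using rad [OF that R] by (simp add: eval_fps_deriv)
  \<comment> \<open>The outer derivative needs the formula for the first derivative on a whole
    neighbourhood of z.\<close>
  have "deriv (deriv (eval_fps F)) z = deriv (eval_fps (fps_deriv F)) z"
  proof (rule deriv_cong_ev)
    have "eventually (\<lambda>w. w \<in> ball 0 1) (nhds z)"
      using z1 by (intro eventually_nhds_in_open) auto
    then show "eventually (\<lambda>w. deriv (eval_fps F) w = eval_fps (fps_deriv F) w) (nhds z)"
      by eventually_elim (simp add: d1)
  qed simp
  then have d2: "deriv (deriv (eval_fps F)) z = eval_fps (fps_deriv (fps_deriv F)) z"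
    using rad [OF z1 R'] by (simp add: eval_fps_deriv)
  have mult: "ereal (norm z) < fps_conv_radius (fps_of_poly p * G)
      \<and> eval_fps (fps_of_poly p * G) z = poly p z * eval_fps G z"
    if "1 \<le> fps_conv_radius G" for p G
  proof
    have "min (fps_conv_radius (fps_of_poly p)) (fps_conv_radius G)
        \<le> fps_conv_radius (fps_of_poly p * G)"
      by (rule fps_conv_radius_mult)
    then show "ereal (norm z) < fps_conv_radius (fps_of_poly p * G)"
      using rad [OF z1 that] by simp
    show "eval_fps (fps_of_poly p * G) z = poly p z * eval_fps G z"
      using rad [OF z1 that] by (simp add: eval_fps_mult)
  qed
  define P where "P = heun_P \<phi> z"
  have P: "P \<noteq> 0"
    using heun_P_nonzero [OF z1] by (simp add: P_def)
  define u where "u = (\<Sum>j=1..4. 1 / (z - heun_pt \<phi> j))"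
  define v where "v = l + (\<Sum>j=1..4. heun_q \<phi> chi j / (z - heun_pt \<phi> j))"
  have u: "poly (pderiv (heun_p \<phi>)) z = P * u" and v: "poly (heun_t \<phi> chi l) z = P * v"
    using heun_sum_inverse [of \<phi> z] heun_sum_q [of \<phi> z l chi] P
    by (simp_all add: P_def u_def v_def)
  have add: "ereal (norm z) < fps_conv_radius (G + H) \<and> eval_fps (G + H) z = eval_fps G z + eval_fps H z"
    if "ereal (norm z) < fps_conv_radius G" "ereal (norm z) < fps_conv_radius H" for G H :: "complex fps"
    using that eval_fps_add [OF that] less_le_trans [OF _ fps_conv_radius_add, of _ G H] by simp
  have "0 = eval_fps (heun_fps \<phi> chi l F) z"
    by (simp add: eq)
  also have "\<dots> = poly (heun_A \<phi>) z * eval_fps (fps_deriv (fps_deriv F)) z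
      + poly (heun_B \<phi>) z * eval_fps (fps_deriv F) z
      + poly (heun_t \<phi> chi l) z * eval_fps F z"
    unfolding heun_fps_def
    by (simp only: add mult [OF R] mult [OF R'] mult [OF R''])
  also have "\<dots> = P ^ 2 * (deriv (deriv (eval_fps F)) z + 1 / 2 * u * deriv (eval_fps F) z
      + 1 / P * v * eval_fps F z)"
    unfolding d2 d1 [OF z1] heun_A_def heun_B_def poly_mult poly_smult u v poly_heun_p P_def [symmetric]
    using P by (simp add: distrib_left power2_eq_square)
  finally show "deriv (deriv (eval_fps F)) z + 1 / 2 * u * deriv (eval_fps F) z
      + 1 / heun_P \<phi> z * v * eval_fps F z = 0"
    using P by (simp add: P_def)
qed

theorem proposition3:
  fixes \<phi> :: real and chi :: "nat \<Rightarrow> complex" and l :: complex and f :: "nat \<Rightarrow> complex"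
  assumes "sin (2 * \<phi>) \<noteq> 0"
    and "\<And>n. n \<ge> 2 \<Longrightarrow>
           f n + (\<Sum>k=1..8. heun_r \<phi> chi l n k * (if k \<le> n then f (n - k) else 0)) = 0"
  shows "(\<forall>z. norm z < 1 \<longrightarrow> summable (\<lambda>n. norm (f n * z ^ n))) \<and>
         heun_solution_on (ball 0 1) \<phi> chi l (\<lambda>z. \<Sum>n. f n * z ^ n)"
proof -
  define F where "F = Abs_fps f"
  \<comment> \<open>The zeros introduced by the shift encode the convention f_m = 0 for m <
    0.\<close>
  have "fps_nth (fps_X ^ k * F) n = (if k \<le> n then f (n - k) else 0)" for k n
    by (simp add: F_def fps_X_power_mult_nth)
  then have rec: "fps_nth F n + (\<Sum>k=1..8. heun_r \<phi> chi l n k * fps_nth (fps_X ^ k * F) n) = 0"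
    if "n \<ge> 2" for n
    using assms(2) [OF that] by (simp add: F_def)
  have R: "1 \<le> fps_conv_radius F"
    using rec by (rule heun_conv_radius)
  have "summable (\<lambda>n. norm (f n * z ^ n))" if "norm z < 1" for z
  proof -
    have "ereal (norm z) < 1"
      using that by (simp add: one_ereal_def)
    then show ?thesis
      using norm_summable_fps [OF less_le_trans [OF _ R]] by (simp add: F_def)
  qed
  moreover have "heun_solution_on (ball 0 1) \<phi> chi l (eval_fps F)"
    using R heun_fps_eq_0 [OF rec] by (rule heun_solution_eval_fps)
  moreover have "eval_fps F = (\<lambda>z. \<Sum>n. f n * z ^ n)"
    by (simp add: eval_fps_def F_def fun_eq_iff)
  ultimately show ?thesis
    by simp
qed

end
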